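(* Let $G$ be a bi-directed graph with finite vertex set $V$, let $G^{\min}$ be a minimally oriented graph of $G$, let $S\in\mathbb{R}^{V\times V}$ be a symmetric positive definite matrix, and let $\hat\Sigma=\hat\Sigma(S)\in\mathbf{P}(G)$ be a solution to the likelihood equations of the covariance graph model associated with $G$. Let $v\in V$ be a vertex such that there is no vertex $w$ with $v\leftrightarrow w\in G^{\min}$, and let $\mathrm{pa}(v)=\{w\in V: w\to v\in G^{\min}\}$. Then the regression coefficients for $v$ given $\mathrm{pa}(v)$ are $$\hat\Sigma_{v\times \mathrm{pa}(v)}\bigl[\hat\Sigma_{\mathrm{pa}(v)\times \mathrm{pa}(v)}\bigr]^{-1}=S_{v\times \mathrm{pa}(v)}\bigl(S_{\mathrm{pa}(v)\times \mathrm{pa}(v)}\bigr)^{-1},$$ and the conditional variance for $v$ given $\mathrm{pa}(v)$ is $$\hat\Sigma_{vv}-\hat\Sigma_{v\times \mathrm{pa}(v)}\bigl[\hat\Sigma_{\mathrm{pa}(v)\times \mathrm{pa}(v)}\bigr]^{-1}\hat\Sigma_{\mathrm{pa}(v)\times v}=S_{vv}-S_{v\times \mathrm{pa}(v)}\bigl(S_{\mathrm{pa}(v)\times \mathrm{pa}(v)}\bigr)^{-1}S_{\mathrm{pa}(v)\times v}.$$ (If $\mathrm{pa}(v)=\emptyset$, conditioning on $\mathrm{pa}(v)$ is understood to yield the marginal distribution of $v$, so the claim reads $\hat\Sigma_{vv}=S_{vv}$.)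
   Context: A simple mixed graph $G=(V,E)$ has a finite vertex set $V$ and at most one edge between any two distinct vertices (no loops), each edge being undirected ($v-w$), directed ($v\to w$ or $v\leftarrow w$), or bi-directed ($v\leftrightarrow w$). An edge $v\leftarrow w$ or $v\leftrightarrow w$ has an arrowhead at $v$; an edge $v\to w$ or $v-w$ has a tail at $v$. A bi-directed graph has only bi-directed edges. Vertices are adjacent if joined by an edge of any type. A path is a sequence of distinct vertices with consecutive ones adjacent. $v$ is an ancestor of $w$ if $v=w$ or there is a directed path $v\to\cdots\to w$; $\mathrm{An}(C)$ is the set of ancestors of elements of $C$. Ancestral graph: a simple mixed graph such that (i) there are no directed cycles; (ii) if $v-w\in G$ then there is no $u$ with $u\to v\in G$ or $u\leftrightarrow v\in G$; (iii) if $v\leftrightarrow w\in G$ then $v$ is not an ancestor of $w$. m-separation: a non-endpoint vertex on a path is a collider if both path edges at it have an arrowhead at it, otherwise a non-collider. A path between $v$ and $w$ is $m$-connecting given $C\subseteq V\setminus\{v,w\}$ if every non-collider on it is not in $C$ and every collider on it is in $\mathrm{An}(C)$. $v,w$ are $m$-separated given $C$ if no path $m$-connects them given $C$; disjoint non-empty sets $A,B$ are $m$-separated given $C\subseteq V\setminus(A\cup B)$ if every $v\in A$ and $w\in B$ are. An ancestral graph is maximal if for every pair of distinct non-adjacent vertices $v,w$ there is some $C\subseteq V\setminus\{v,w\}$ such that $v,w$ are $m$-separated given $C$. Two ancestral graphs on the same vertex set are Markov equivalent if they have the same $m$-separations (the same triples $(A,B,C)$ with $A,B$ $m$-separated given $C$).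 Minimally oriented graph of a bi-directed graph $G$: a graph $G^{\min}$ such that (i) $G^{\min}$ is a maximal ancestral graph; (ii) $G$ and $G^{\min}$ are Markov equivalent; (iii) $G^{\min}$ has the minimum number of arrowheads among all maximal ancestral graphs Markov equivalent to $G$, where the number of arrowheads of a graph with $d$ directed and $b$ bi-directed edges is $d+2b$. Covariance graph model: $\mathbf{P}(G)$ is the set of symmetric positive definite matrices $\Sigma=(\sigma_{vw})\in\mathbb{R}^{V\times V}$ with $\sigma_{vw}=0$ for all $v\neq w$ such that $v\leftrightarrow w\notin G$. The covariance graph model associated with $G$ is the family of normal distributions $\mathcal{N}_V(0,\Sigma)$, $\Sigma\in\mathbf{P}(G)$. A solution to its likelihood equations is a matrix $\Sigma\in\mathbf{P}(G)$ satisfying $$(\Sigma^{-1})_{vw}=(\Sigma^{-1}S\Sigma^{-1})_{vw}\quad\text{for all } v,w\in V \text{ with } v=w \text{ or } v\leftrightarrow w\in G.$$ For a matrix $M$, $M_{A\times B}$ denotes the submatrix with rows indexed by $A$ and columns by $B$ (with $v$ standing for $\{v\}$). *)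

theory Defs
  imports "HOL-Analysis.Analysis"
begin

section \<open>Mixed graphs\<close>

text \<open>
  The vertex set is the carrier of a finite type. A directed edge from v to w is the pair (v, w);
  undirected and bi-directed edges are two-element sets of vertices, so that each edge is
  counted once by \<open>card\<close>.
\<close>

record 'v mixed_graph =
  directed :: "('v \<times> 'v) set"
  undirected :: "'v set set"
  bidirected :: "'v set set"

definition simple_mixed_graph :: "('v::finite) mixed_graph \<Rightarrow> bool" where
  "simple_mixed_graph G \<longleftrightarrow>
     (\<forall>e \<in> undirected G \<union> bidirected G. card e = 2) \<and>
     undirected G \<inter> bidirected G = {} \<and>
     (\<forall>v w. (v, w) \<in> directed G \<longrightarrow>
        v \<noteq> w \<and> (w, v) \<notin> directed G \<and> {v, w} \<notin> undirected G \<union> bidirected G)"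

definition bidirected_graph :: "('v::finite) mixed_graph \<Rightarrow> bool" where
  "bidirected_graph G \<longleftrightarrow>
     simple_mixed_graph G \<and> directed G = {} \<and> undirected G = {}"

definition adjacent :: "('v::finite) mixed_graph \<Rightarrow> 'v \<Rightarrow> 'v \<Rightarrow> bool" where
  "adjacent G v w \<longleftrightarrow>
     (v, w) \<in> directed G \<or> (w, v) \<in> directed G \<or>
     {v, w} \<in> undirected G \<or> {v, w} \<in> bidirected G"

text \<open>The edge between v and w has an arrowhead at v.\<close>

definition arrowhead_at :: "('v::finite) mixed_graph \<Rightarrow> 'v \<Rightarrow> 'v \<Rightarrow> bool" where
  "arrowhead_at G v w \<longleftrightarrow> (w, v) \<in> directed G \<or> {v, w} \<in> bidirected G"

definition arrowheads :: "('v::finite) mixed_graph \<Rightarrow> nat" where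
  "arrowheads G = card (directed G) + 2 * card (bidirected G)"

definition parents :: "('v::finite) mixed_graph \<Rightarrow> 'v \<Rightarrow> 'v set" where
  "parents G v = {w. (w, v) \<in> directed G}"

definition ancestors :: "('v::finite) mixed_graph \<Rightarrow> 'v set \<Rightarrow> 'v set" where
  "ancestors G C = {v. \<exists>w \<in> C. (v, w) \<in> (directed G)\<^sup>*}"

definition ancestral_graph :: "('v::finite) mixed_graph \<Rightarrow> bool" where
  "ancestral_graph G \<longleftrightarrow>
     simple_mixed_graph G \<and>
     acyclic (directed G) \<and>
     (\<forall>v w. {v, w} \<in> undirected G \<longrightarrow>
        \<not> (\<exists>u. (u, v) \<in> directed G \<or> {u, v} \<in> bidirected G)) \<and>
     (\<forall>v w. {v, w} \<in> bidirected G \<longrightarrow> v \<notin> ancestors G {w})"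


section \<open>m-separation and Markov equivalence\<close>

definition path_between :: "('v::finite) mixed_graph \<Rightarrow> 'v \<Rightarrow> 'v \<Rightarrow> 'v list \<Rightarrow> bool" where
  "path_between G v w p \<longleftrightarrow>
     p \<noteq> [] \<and> hd p = v \<and> last p = w \<and> distinct p \<and>
     (\<forall>i. Suc i < length p \<longrightarrow> adjacent G (p ! i) (p ! Suc i))"

text \<open>Only meaningful at non-endpoint positions, that is, for \<open>0 < i\<close> and \<open>Suc i < length p\<close>.\<close>

definition collider_at :: "('v::finite) mixed_graph \<Rightarrow> 'v list \<Rightarrow> nat \<Rightarrow> bool" where
  "collider_at G p i \<longleftrightarrow>
     arrowhead_at G (p ! i) (p ! (i - 1)) \<and> arrowhead_at G (p ! i) (p ! Suc i)"

definition m_connecting ::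
  "('v::finite) mixed_graph \<Rightarrow> 'v \<Rightarrow> 'v \<Rightarrow> 'v set \<Rightarrow> 'v list \<Rightarrow> bool" where
  "m_connecting G v w C p \<longleftrightarrow>
     path_between G v w p \<and>
     (\<forall>i. 0 < i \<and> Suc i < length p \<longrightarrow>
        (if collider_at G p i then p ! i \<in> ancestors G C else p ! i \<notin> C))"

text \<open>
  The side conditions on the sets (A and B disjoint and non-empty, C disjoint from both)
  are imposed where this predicate is used.
\<close>

definition m_separated ::
  "('v::finite) mixed_graph \<Rightarrow> 'v set \<Rightarrow> 'v set \<Rightarrow> 'v set \<Rightarrow> bool" where
  "m_separated G A B C \<longleftrightarrow> (\<forall>v \<in> A. \<forall>w \<in> B. \<not> (\<exists>p. m_connecting G v w C p))"

definition maximal_ancestral_graph :: "('v::finite) mixed_graph \<Rightarrow> bool" where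
  "maximal_ancestral_graph G \<longleftrightarrow>
     ancestral_graph G \<and>
     (\<forall>v w. v \<noteq> w \<and> \<not> adjacent G v w \<longrightarrow>
        (\<exists>C. C \<subseteq> - {v, w} \<and> m_separated G {v} {w} C))"

definition Markov_equivalent :: "('v::finite) mixed_graph \<Rightarrow> 'v mixed_graph \<Rightarrow> bool" where
  "Markov_equivalent G H \<longleftrightarrow>
     (\<forall>A B C. A \<noteq> {} \<and> B \<noteq> {} \<and> A \<inter> B = {} \<and> C \<subseteq> - (A \<union> B) \<longrightarrow>
        (m_separated G A B C \<longleftrightarrow> m_separated H A B C))"

definition minimally_oriented_graph ::
  "('v::finite) mixed_graph \<Rightarrow> 'v mixed_graph \<Rightarrow> bool" where
  "minimally_oriented_graph G Gmin \<longleftrightarrow>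
     maximal_ancestral_graph Gmin \<and>
     Markov_equivalent G Gmin \<and>
     (\<forall>H. maximal_ancestral_graph H \<and> Markov_equivalent G H \<longrightarrow>
        arrowheads Gmin \<le> arrowheads H)"


section \<open>Covariance graph models\<close>

definition sym_pos_def :: "real^'v^('v::finite) \<Rightarrow> bool" where
  "sym_pos_def M \<longleftrightarrow> transpose M = M \<and> (\<forall>x. x \<noteq> 0 \<longrightarrow> 0 < x \<bullet> (M *v x))"

text \<open>\<open>covariance_matrices G\<close> is the set P(G) parametrizing the covariance graph model of G.\<close>

definition covariance_matrices :: "('v::finite) mixed_graph \<Rightarrow> (real^'v^'v) set" where
  "covariance_matrices G =
     {\<Sigma>. sym_pos_def \<Sigma> \<and> (\<forall>v w. v \<noteq> w \<and> {v, w} \<notin> bidirected G \<longrightarrow> \<Sigma> $ v $ w = 0)}"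

definition likelihood_solution ::
  "('v::finite) mixed_graph \<Rightarrow> real^'v^'v \<Rightarrow> real^'v^'v \<Rightarrow> bool" where
  "likelihood_solution G S \<Sigma> \<longleftrightarrow>
     \<Sigma> \<in> covariance_matrices G \<and>
     (\<forall>v w. v = w \<or> {v, w} \<in> bidirected G \<longrightarrow>
        matrix_inv \<Sigma> $ v $ w = (matrix_inv \<Sigma> ** S ** matrix_inv \<Sigma>) $ v $ w)"


section \<open>Submatrices\<close>

text \<open>
  Since A and B are sets rather than types, an A by B matrix is represented by the full-size
  matrix that agrees with it on A times B and vanishes elsewhere. The product \<open>**\<close> of an A by B
  and a B by C matrix in this representation is their ordinary product, and the identity
  matrix indexed by A is \<open>submat (mat 1) A A\<close>.
\<close>

definition submat ::
  "real^'v^('v::finite) \<Rightarrow> 'v set \<Rightarrow> 'v set \<Rightarrow> real^'v^'v" where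
  "submat M A B = (\<chi> i j. if i \<in> A \<and> j \<in> B then M $ i $ j else 0)"

text \<open>
  The inverse of N among the A by A matrices, defined as \<open>matrix_inv\<close> is but relative to the
  index set A. For empty A it is the zero matrix.
\<close>

definition submat_inv :: "'v set \<Rightarrow> real^'v^('v::finite) \<Rightarrow> real^'v^'v" where
  "submat_inv A N =
     (SOME N'. submat N' A A = N' \<and>
        N ** N' = submat (mat 1) A A \<and> N' ** N = submat (mat 1) A A)"

lemma submat_UNIV: "submat M UNIV UNIV = M"
  by (simp add: submat_def vec_eq_iff)

lemma submat_inv_UNIV: "submat_inv UNIV N = matrix_inv N"
  by (simp add: submat_inv_def matrix_inv_def submat_UNIV)

lemma submat_inv_empty: "submat_inv {} (submat M {} {}) = 0"
  unfolding submat_inv_def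
  by (rule some_equality) (auto simp: submat_def vec_eq_iff matrix_matrix_mult_def)

end

theory Submission
  imports Defs
begin

text \<open>
  Put \<open>M = \<Sigma>\<^sup>-\<^sup>1 - \<Sigma>\<^sup>-\<^sup>1 S \<Sigma>\<^sup>-\<^sup>1\<close>, so that \<open>\<Sigma> - S = \<Sigma> M \<Sigma>\<close> and the likelihood equations say that M vanishes
  on the diagonal and on the edges of G. Let u be the coefficient vector of the residual of v
  regressed on pa(v) under \<open>\<Sigma>\<close>. It suffices that \<open>u\<^sup>T \<Sigma> M \<Sigma> e\<^sub>x = 0\<close> for x in pa(v) and for x = v.
  Two vertices are marginally independent in the graph G exactly if they are not adjacent, and a
  path of length two without a collider m-connects its endpoints given the empty set. Hence in any
  maximal ancestral graph equivalent to G the endpoints of such a path are adjacent.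
  Applied at a parent of v this shows that every neighbour of a parent is v or a neighbour
  of v. So \<open>\<Sigma> e\<^sub>x\<close> is supported on v and its neighbours, and \<open>u\<^sup>T \<Sigma>\<close> on v and those neighbours a
  whose edge has a tail at v. Applied at v, it shows that such an a is adjacent to all other
  neighbours of v, so M vanishes wherever these supports meet.
\<close>

section \<open>Markov equivalence to a bi-directed graph\<close>

lemma adjacent_commute: "adjacent G v w \<longleftrightarrow> adjacent G w v"
  by (auto simp: adjacent_def insert_commute)

lemma adjacent_not_refl:
  assumes "simple_mixed_graph G"
  shows "\<not> adjacent G v v"
proof -
  have "card {v} \<noteq> 2" by simp
  then have "{v} \<notin> undirected G \<union> bidirected G"
    using assms unfolding simple_mixed_graph_def by metis
  moreover have "(v, v) \<notin> directed G"
    using assms unfolding simple_mixed_graph_def by blast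
  ultimately show ?thesis by (simp add: adjacent_def)
qed

lemma bidirected_graph_adjacent:
  "bidirected_graph G \<Longrightarrow> adjacent G v w \<longleftrightarrow> {v, w} \<in> bidirected G"
  by (auto simp: adjacent_def bidirected_graph_def)

lemma adjacent_imp_not_m_separated:
  assumes "adjacent G v w" "v \<noteq> w"
  shows "\<not> m_separated G {v} {w} C"
proof -
  have "m_connecting G v w C [v, w]"
    using assms by (auto simp: m_connecting_def path_between_def)
  then show ?thesis by (auto simp: m_separated_def)
qed

lemma non_collider_imp_not_m_separated:
  assumes "adjacent G v c" "adjacent G c w" "v \<noteq> w" "c \<noteq> v" "c \<noteq> w"
    and "\<not> (arrowhead_at G c v \<and> arrowhead_at G c w)"
  shows "\<not> m_separated G {v} {w} {}"
proof -
  have "m_connecting G v w {} [v, c, w]"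
    using assms
    by (auto simp: m_connecting_def path_between_def collider_at_def less_Suc_eq)
  then show ?thesis by (auto simp: m_separated_def)
qed

text \<open>Every inner vertex of a path in a bi-directed graph is a collider, and the empty set has
  no ancestors, so only a single edge can m-connect given the empty set.\<close>

lemma bidirected_graph_m_separated_empty:
  assumes G: "bidirected_graph G" and "\<not> adjacent G v w" "v \<noteq> w"
  shows "m_separated G {v} {w} {}"
proof -
  have False if p: "m_connecting G v w {} p" for p
  proof -
    from p have path: "p \<noteq> []" "hd p = v" "last p = w"
      and adj: "\<And>i. Suc i < length p \<Longrightarrow> adjacent G (p ! i) (p ! Suc i)"
      and mid: "\<And>i. 0 < i \<Longrightarrow> Suc i < length p \<Longrightarrow> \<not> collider_at G p i"
      by (auto simp: m_connecting_def path_between_def ancestors_def split: if_splits)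
    have coll: "collider_at G p 1" if "Suc 1 < length p"
      using adj[of 0] adj[of 1] that
      by (simp add: collider_at_def arrowhead_at_def bidirected_graph_adjacent[OF G] insert_commute)
    have "length p \<noteq> 1" using path \<open>v \<noteq> w\<close> by (auto simp: length_Suc_conv)
    moreover have "length p \<noteq> 2"
      using path adj[of 0] \<open>\<not> adjacent G v w\<close> by (auto simp: length_Suc_conv numeral_2_eq_2)
    moreover have "length p \<noteq> 0" using path by simp
    ultimately have "Suc 1 < length p" by linarith
    with coll mid[of 1] show False by simp
  qed
  then show ?thesis by (auto simp: m_separated_def)
qed

lemma Markov_equivalent_m_separated:
  assumes "Markov_equivalent G H" "v \<noteq> w" "C \<subseteq> - {v, w}"
  shows "m_separated G {v} {w} C \<longleftrightarrow> m_separated H {v} {w} C"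
proof -
  have "C \<subseteq> - ({v} \<union> {w})" "{v} \<inter> {w} = {}" using assms by auto
  then show ?thesis using assms(1) unfolding Markov_equivalent_def by blast
qed

text \<open>An edge of \<open>H\<close> rules out separation given the empty set, which
  non-adjacency in \<open>G\<close> would yield. Conversely, maximality gives non-adjacent vertices
  of \<open>H\<close> a separating set, which would also separate them in \<open>G\<close>.\<close>

lemma Markov_equivalent_adjacent:
  assumes "bidirected_graph G" "maximal_ancestral_graph H" "Markov_equivalent G H" "v \<noteq> w"
  shows "adjacent G v w \<longleftrightarrow> adjacent H v w"
proof
  assume "adjacent H v w"
  then have "\<not> m_separated H {v} {w} {}" using \<open>v \<noteq> w\<close> by (rule adjacent_imp_not_m_separated)
  with assms show "adjacent G v w"
    using bidirected_graph_m_separated_empty Markov_equivalent_m_separated[of G H v w "{}"]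
    by auto
next
  assume G: "adjacent G v w"
  show "adjacent H v w"
  proof (rule ccontr)
    assume "\<not> adjacent H v w"
    then obtain C where "C \<subseteq> - {v, w}" "m_separated H {v} {w} C"
      using assms(2) \<open>v \<noteq> w\<close> unfolding maximal_ancestral_graph_def by blast
    then show False
      using adjacent_imp_not_m_separated[OF G \<open>v \<noteq> w\<close>, of C]
        Markov_equivalent_m_separated[OF assms(3,4), of C] by simp
  qed
qed

text \<open>The path \<open>[v, c, w]\<close> exists in \<open>H\<close> as well and m-connects
  given the empty set there; transferred to \<open>G\<close>, this forces an edge.\<close>

lemma Markov_equivalent_non_collider_adjacent:
  assumes "bidirected_graph G" "maximal_ancestral_graph H" "Markov_equivalent G H"
    and "adjacent G v c" "adjacent G c w" "v \<noteq> w"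
    and "\<not> (arrowhead_at H c v \<and> arrowhead_at H c w)"
  shows "adjacent G v w"
proof -
  have "simple_mixed_graph G" using assms(1) by (simp add: bidirected_graph_def)
  then have neq: "c \<noteq> v" "c \<noteq> w" using adjacent_not_refl assms(4,5) by metis+
  then have "adjacent H v c" "adjacent H c w"
    using Markov_equivalent_adjacent[OF assms(1-3)] assms(4,5) by simp_all
  then have "\<not> m_separated H {v} {w} {}"
    using non_collider_imp_not_m_separated neq assms(6,7) by blast
  then show ?thesis
    using bidirected_graph_m_separated_empty[OF assms(1)]
      Markov_equivalent_m_separated[OF assms(3,6), of "{}"] assms(6) by blast
qed

section \<open>Submatrices of positive definite matrices\<close>

lemma sum_submat_left:
  "(\<Sum>k\<in>UNIV. submat M A B $ i $ k * x k) = (if i \<in> A then \<Sum>k\<in>B. M $ i $ k * x k else 0)"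
  by (auto simp: submat_def if_distrib[of "\<lambda>y. y * _"] sum.If_cases)

lemma sum_submat_right:
  "(\<Sum>k\<in>UNIV. x k * submat M A B $ k $ j) = (if j \<in> B then \<Sum>k\<in>A. x k * M $ k $ j else 0)"
  by (auto simp: submat_def if_distrib[of "\<lambda>y. _ * y"] sum.If_cases)

lemma submat_mult: "submat M A B ** submat N B C = (\<chi> i j. if i \<in> A \<and> j \<in> C
    then \<Sum>k\<in>B. M $ i $ k * N $ k $ j else 0)"
  by (auto simp: vec_eq_iff matrix_matrix_mult_def sum_submat_left) (auto simp: submat_def)

lemma submat_mult_one: "submat M A B ** submat (mat 1) B B = submat M A B"
  unfolding submat_mult by (auto simp: vec_eq_iff submat_def mat_def if_distrib cong: if_cong)

lemma submat_inv:
  fixes M :: "real^'v^('v::finite)" and A :: "'v set"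
  assumes M: "sym_pos_def M"
  defines "K \<equiv> submat_inv A (submat M A A)"
  shows "submat K A A = K"
    and "submat M A A ** K = submat (mat 1) A A"
    and "K ** submat M A A = submat (mat 1) A A"
proof -
  \<comment> \<open>\<open>T\<close> pads the \<open>A\<close> block of \<open>M\<close> with the
    identity, so that invertibility of full matrices applies; the \<open>A\<close> block of its
    inverse is the inverse sought.\<close>
  define T :: "real^'v^'v" where "T = (\<chi> i j. if i \<in> A \<and> j \<in> A then M $ i $ j else mat 1 $ i $ j)"
  have T_A: "T $ i $ k = (if k \<in> A then M $ i $ k else 0)"
    "T $ k $ i = (if k \<in> A then M $ k $ i else 0)" if "i \<in> A" for i k
    using that by (auto simp: T_def mat_def)
  have "x = 0" if x: "T *v x = 0" for x
  proof (rule ccontr)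
    assume "x \<noteq> 0"
    \<comment> \<open>A kernel vector of \<open>T\<close> vanishes outside \<open>A\<close>, and on
      \<open>A\<close> it is annihilated by \<open>M\<close>, so the quadratic form of
      \<open>M\<close> is zero at it.\<close>
    have "(T *v x) $ i = x $ i" if "i \<notin> A" for i
      using that
      by (simp add: matrix_vector_mult_def T_def mat_def if_distrib[of "\<lambda>y. y * _"] cong: if_cong)
    then have out: "x $ i = 0" if "i \<notin> A" for i using x that by simp
    have "(M *v x) $ i = (T *v x) $ i" if "i \<in> A" for i
      using that out by (auto simp: matrix_vector_mult_def T_A intro!: sum.cong)
    then have "(M *v x) $ i = 0" if "i \<in> A" for i using x that by simp
    then have "x \<bullet> (M *v x) = 0"
      unfolding inner_vec_def using out by (intro sum.neutral) (metis inner_zero_left inner_zero_right)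
    then show False using M \<open>x \<noteq> 0\<close> unfolding sym_pos_def_def by (metis less_irrefl)
  qed
  then have "invertible T" using invertible_left_inverse matrix_left_invertible_ker by blast
  then obtain T' where T': "T ** T' = mat 1" "T' ** T = mat 1" unfolding invertible_def by blast
  have sub: "submat (submat T' A A) A A = submat T' A A"
    by (simp add: submat_def vec_eq_iff)
  have right: "submat M A A ** submat T' A A = submat (mat 1) A A"
  proof -
    have "(\<Sum>k\<in>A. M $ i $ k * T' $ k $ j) = mat 1 $ i $ j" if "i \<in> A" for i j
    proof -
      have "(\<Sum>k\<in>A. M $ i $ k * T' $ k $ j) = (T ** T') $ i $ j"
        using that
        by (simp add: matrix_matrix_mult_def T_A if_distrib[of "\<lambda>y. y * _"] sum.If_cases)
      then show ?thesis by (simp add: T')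
    qed
    then show ?thesis unfolding submat_mult by (simp add: vec_eq_iff submat_def)
  qed
  have left: "submat T' A A ** submat M A A = submat (mat 1) A A"
  proof -
    have "(\<Sum>k\<in>A. T' $ i $ k * M $ k $ j) = mat 1 $ i $ j" if "j \<in> A" for i j
    proof -
      have "(\<Sum>k\<in>A. T' $ i $ k * M $ k $ j) = (T' ** T) $ i $ j"
        using that
        by (simp add: matrix_matrix_mult_def T_A if_distrib[of "\<lambda>y. _ * y"] sum.If_cases)
      then show ?thesis by (simp add: T')
    qed
    then show ?thesis unfolding submat_mult by (simp add: vec_eq_iff submat_def)
  qed
  have "submat K A A = K \<and> submat M A A ** K = submat (mat 1) A A \<and>
      K ** submat M A A = submat (mat 1) A A"
    unfolding K_def submat_inv_def by (rule someI[of _ "submat T' A A"]) (use sub right left in blast)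
  then show "submat K A A = K" "submat M A A ** K = submat (mat 1) A A"
    "K ** submat M A A = submat (mat 1) A A" by auto
qed

section \<open>Likelihood equations and the regression on the parents\<close>

lemma matrix_diff_ldistrib: "A ** (B - C) = A ** B - A ** (C :: 'a::ring_1^_^_)"
  by (simp add: matrix_matrix_mult_def vec_eq_iff right_diff_distrib sum_subtractf)

lemma matrix_diff_rdistrib: "(A - B) ** C = A ** C - B ** (C :: 'a::ring_1^_^_)"
  by (simp add: matrix_matrix_mult_def vec_eq_iff left_diff_distrib sum_subtractf)

lemma likelihood_solution_residual:
  assumes "likelihood_solution G S \<Sigma>"
  obtains M where "\<Sigma> - S = \<Sigma> ** M ** \<Sigma>"
    and "\<And>a b. a = b \<or> {a, b} \<in> bidirected G \<Longrightarrow> M $ a $ b = 0"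
proof
  let ?I = "matrix_inv \<Sigma>"
  let ?M = "?I - ?I ** S ** ?I"
  have "sym_pos_def \<Sigma>"
    using assms by (simp add: likelihood_solution_def covariance_matrices_def)
  then have inv: "?I ** \<Sigma> = mat 1" "\<Sigma> ** ?I = mat 1"
    using submat_inv[of \<Sigma> UNIV] by (simp_all add: submat_UNIV submat_inv_UNIV)
  have "\<Sigma> ** ?M ** \<Sigma> = (\<Sigma> ** ?I) ** \<Sigma> - (\<Sigma> ** ?I) ** S ** (?I ** \<Sigma>)"
    by (simp add: matrix_diff_ldistrib matrix_diff_rdistrib matrix_mul_assoc)
  then show "\<Sigma> - S = \<Sigma> ** ?M ** \<Sigma>" by (simp add: inv)
  show "?M $ a $ b = 0" if "a = b \<or> {a, b} \<in> bidirected G" for a b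
  proof -
    have "?I $ a $ b = (?I ** S ** ?I) $ a $ b"
      using assms that unfolding likelihood_solution_def by blast
    then show ?thesis by simp
  qed
qed

theorem theorem23:
  fixes G Gmin :: "('v::finite) mixed_graph"
    and S \<Sigma> :: "real^'v^'v"
    and v :: 'v
    and P :: "'v set"
  assumes "bidirected_graph G"
    and "minimally_oriented_graph G Gmin"
    and "sym_pos_def S"
    and "likelihood_solution G S \<Sigma>"
    and "\<not> (\<exists>w. {v, w} \<in> bidirected Gmin)"
    and P_def: "P = parents Gmin v"
  shows "submat \<Sigma> {v} P ** submat_inv P (submat \<Sigma> P P) =
         submat S {v} P ** submat_inv P (submat S P P) \<and>
         \<Sigma> $ v $ v - (submat \<Sigma> {v} P ** submat_inv P (submat \<Sigma> P P) ** submat \<Sigma> P {v}) $ v $ v =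
         S $ v $ v - (submat S {v} P ** submat_inv P (submat S P P) ** submat S P {v}) $ v $ v"
proof -
  have max: "maximal_ancestral_graph Gmin" and equiv: "Markov_equivalent G Gmin"
    using assms(2) by (auto simp: minimally_oriented_graph_def)
  then have simple: "simple_mixed_graph Gmin"
    by (simp add: maximal_ancestral_graph_def ancestral_graph_def)
  note non_collider = Markov_equivalent_non_collider_adjacent[OF assms(1) max equiv]
  have spd: "sym_pos_def \<Sigma>"
    and zero: "\<And>a b. a \<noteq> b \<Longrightarrow> \<not> adjacent G a b \<Longrightarrow> \<Sigma> $ a $ b = 0"
    using assms(4) bidirected_graph_adjacent[OF assms(1)]
    by (auto simp: likelihood_solution_def covariance_matrices_def)
  obtain M where M: "\<Sigma> - S = \<Sigma> ** M ** \<Sigma>"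
    and "\<And>a b. a = b \<or> {a, b} \<in> bidirected G \<Longrightarrow> M $ a $ b = 0"
    using likelihood_solution_residual[OF assms(4)] by blast
  then have M0: "\<And>a b. a = b \<or> adjacent G a b \<Longrightarrow> M $ a $ b = 0"
    using bidirected_graph_adjacent[OF assms(1)] by blast
  have "v \<notin> P" using simple by (auto simp: P_def parents_def simple_mixed_graph_def)
  have P_tail: "\<not> arrowhead_at Gmin p v" if "p \<in> P" for p
    using that simple assms(5)
    by (auto simp: P_def parents_def simple_mixed_graph_def arrowhead_at_def insert_commute)
  have P_adj: "adjacent G p v" if "p \<in> P" for p
    using that Markov_equivalent_adjacent[OF assms(1) max equiv, of p v] \<open>v \<notin> P\<close>
    by (auto simp: P_def parents_def adjacent_def)
  \<comment> \<open>The edge from \<open>p\<close> to \<open>v\<close> has its tail at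
    \<open>p\<close>, so \<open>p\<close> is a non-collider between \<open>b\<close> and
    \<open>v\<close>.\<close>
  have P_nbrs: "b = v \<or> adjacent G b v" if "p \<in> P" "b = p \<or> adjacent G b p" for p b
    using that P_adj P_tail non_collider[of b p v] by blast
  have v_tail: "\<not> arrowhead_at Gmin v a" if "a \<notin> P" for a
    using that assms(5) by (auto simp: P_def parents_def arrowhead_at_def)

  let ?K = "submat_inv P (submat \<Sigma> P P)" and ?L = "submat_inv P (submat S P P)"
  \<comment> \<open>Row \<open>v\<close> of \<open>B\<close> holds the regression coefficients under
    \<open>\<Sigma>\<close>; \<open>B\<Sigma>\<close> below states their normal equations.\<close>
  define B where "B = submat \<Sigma> {v} P ** ?K"
  note K = submat_inv[OF spd, of P] and L = submat_inv[OF assms(3), of P]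
  have "B ** submat \<Sigma> P P = submat \<Sigma> {v} P"
    by (simp add: B_def matrix_mul_assoc[symmetric] K submat_mult_one)
  then have B_row: "(B ** submat \<Sigma> P P) $ v $ p = submat \<Sigma> {v} P $ v $ p" for p by simp
  have B\<Sigma>: "(\<Sum>k\<in>P. B $ v $ k * \<Sigma> $ k $ p) = \<Sigma> $ v $ p" if "p \<in> P" for p
    using B_row[of p] that by (simp add: matrix_matrix_mult_def[of B] sum_submat_right submat_def[of _ "{v}"])
  have "B = submat \<Sigma> {v} P ** submat ?K P P" by (simp add: B_def K)
  then have B_submat: "submat B {v} P = B"
    by (simp add: submat_mult) (auto simp: submat_def vec_eq_iff)

  \<comment> \<open>\<open>r N x\<close> is entry \<open>x\<close> of the row vector
    \<open>u\<^sup>T N\<close>, where \<open>u\<close> is 1 at \<open>v\<close> and minus the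
    coefficients on \<open>P\<close>. Under covariance \<open>N\<close> it is the covariance of the
    residual with \<open>x\<close>.\<close>
  define r where "r N x = N $ v $ x - (\<Sum>k\<in>P. B $ v $ k * N $ k $ x)" for N :: "real^'v^'v" and x
  have r_mult: "r (N ** N') x = (\<Sum>a\<in>UNIV. r N a * N' $ a $ x)" for N N' x
    unfolding r_def matrix_matrix_mult_def
    by (simp add: left_diff_distrib sum_subtractf sum_distrib_left sum_distrib_right mult.assoc
        sum.swap[of _ P])
  \<comment> \<open>On \<open>P\<close> the normal equations make \<open>r \<Sigma>\<close> vanish.
    A vertex that is neither \<open>v\<close> nor adjacent to \<open>v\<close> has no neighbour in
    \<open>P\<close>, so every term of \<open>r \<Sigma>\<close> is zero there.\<close>
  have r_supp: "a \<notin> P \<and> (a = v \<or> adjacent G a v)" if "r \<Sigma> a \<noteq> 0" for a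
  proof (rule ccontr)
    assume neg: "\<not> ?thesis"
    show False
    proof (cases "a \<in> P")
      case True
      then show ?thesis using that by (simp add: r_def B\<Sigma>)
    next
      case False
      then have a: "a \<noteq> v" "\<not> adjacent G a v" using neg by auto
      then have "\<Sigma> $ k $ a = 0" if "k \<in> P" for k
        using zero[of k a] P_nbrs[of k a] that adjacent_commute by blast
      moreover have "\<Sigma> $ v $ a = 0" using a zero[of v a] adjacent_commute by blast
      ultimately show ?thesis using that by (simp add: r_def)
    qed
  qed
  \<comment> \<open>The cases \<open>x\<close> in \<open>P\<close> will give the normal equations
    under \<open>S\<close>, and \<open>x = v\<close> the conditional variance.\<close>
  have r_diff: "r \<Sigma> x = r S x" if x: "x \<in> insert v P" for x
  proof -
    have "r \<Sigma> a * M $ a $ b * \<Sigma> $ b $ x = 0" for a b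
    proof (rule ccontr)
      assume "\<not> ?thesis"
      then have nz: "r \<Sigma> a \<noteq> 0" "M $ a $ b \<noteq> 0" "\<Sigma> $ b $ x \<noteq> 0" by auto
      from nz(1) have a: "a \<notin> P" "a = v \<or> adjacent G a v" using r_supp by auto
      from nz(3) have "b = x \<or> adjacent G b x" using zero by blast
      then have b: "b = v \<or> adjacent G b v" using x P_nbrs by blast
      \<comment> \<open>If \<open>a\<close> and \<open>b\<close> are distinct and both differ from
        \<open>v\<close>, they are joined through \<open>v\<close>, a non-collider because its edge
        to \<open>a\<close> has a tail at \<open>v\<close>.\<close>
      have "a = b \<or> adjacent G a b"
        using a b v_tail[OF a(1)] non_collider[of a v b] adjacent_commute by blast
      then show False using M0 nz(2) by blast
    qed
    then have "r (\<Sigma> ** M ** \<Sigma>) x = 0"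
      by (simp only: r_mult sum_distrib_right sum.neutral_const)
    moreover have "r (\<Sigma> - S) x = r \<Sigma> x - r S x"
      by (simp add: r_def right_diff_distrib sum_subtractf)
    ultimately show ?thesis by (simp add: M)
  qed

  have "B ** submat S P P = submat S {v} P"
  proof -
    \<comment> \<open>\<open>B\<close> solves the normal equations under \<open>S\<close> too;
      cancelling the \<open>P\<close> block of \<open>S\<close> with \<open>?L\<close> then
      identifies it with the coefficients under \<open>S\<close>.\<close>
    have "(\<Sum>k\<in>P. B $ v $ k * S $ k $ p) = S $ v $ p" if "p \<in> P" for p
      using r_diff[of p] B\<Sigma>[OF that] that by (simp add: r_def)
    then have "submat B {v} P ** submat S P P = submat S {v} P"
      by (auto simp: submat_mult vec_eq_iff submat_def[of S "{v}"])
    then show ?thesis by (simp add: B_submat)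
  qed
  then have "B ** (submat S P P ** ?L) = submat S {v} P ** ?L"
    by (simp add: matrix_mul_assoc)
  moreover have "B ** submat (mat 1) P P = B"
    using submat_mult_one[of B "{v}" P] by (simp add: B_submat)
  ultimately have B: "B = submat S {v} P ** ?L" by (simp add: L)
  \<comment> \<open>With \<open>B\<close> common to \<open>\<Sigma>\<close> and \<open>S\<close>,
    the conditional variances are the values of \<open>r\<close> at \<open>v\<close>.\<close>
  have "N $ v $ v - (B ** submat N P {v}) $ v $ v = r N v" for N
    by (simp add: r_def matrix_matrix_mult_def[of B] sum_submat_right)
  then have "\<Sigma> $ v $ v - (B ** submat \<Sigma> P {v}) $ v $ v = S $ v $ v - (B ** submat S P {v}) $ v $ v"
    using r_diff[of v] by simp
  then show ?thesis using B by (simp add: B_def)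
qed

end
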